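(* Let $k$ be a positive integer and let $\mathcal{A}$ be a non-trivial monotone family of subsets of $[n]$ with all minterms of size at most $k$. Then for $0<\epsilon<1$, $$1-2\epsilon\,\frac{(k-1)^{k-1}}{k^k}\ \ge\ \delta_\epsilon(\mathcal{A}).$$
   Context: Let $[n]=\{0,1,\ldots,n\}$. For $p\in[0,1]$, $[n]_p$ denotes a random subset of $[n]$ in which each element is included independently with probability $p$. For a family $\mathcal{A}$ of subsets of $[n]$, $\mu(\mathcal{A},p)=\Pr([n]_p\in\mathcal{A})$. A family $\mathcal{A}$ is monotone if $A\in\mathcal{A}$ and $A\subset B\subseteq [n]$ imply $B\in\mathcal{A}$. A minterm of $\mathcal{A}$ is a member of $\mathcal{A}$ that is minimal with respect to inclusion. A monotone family is non-trivial if it is neither empty nor the whole power set of $[n]$. For a non-trivial monotone family $\mathcal{A}$ and $x\in[0,1]$, $p_x$ is the unique number in $[0,1]$ with $\mu(\mathcal{A},p_x)=x$. For $0<\epsilon<1$ define $\delta_\epsilon(\mathcal{A})=\frac{p_{1/2}-p_\epsilon}{p_{1/2}}$.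
   Formalization: For k=1 the formal theorem requires ε≥1/2: with 0^0=1 the inequality fails for k=1 and ε<1/2 whenever there are at least two minterms (e.g. all nonempty subsets of {0,1}, ε=1/4: δ≈0.543>0.5); with one minterm it is a trivial equality. Nothing is restricted for k≥2. *)

theory Defs
  imports "HOL-Probability.Probability"
begin

definition random_subset :: "nat \<Rightarrow> real \<Rightarrow> nat set pmf" where
  "random_subset n p =
     map_pmf (\<lambda>f. {i \<in> {0..n}. f i}) (Pi_pmf {0..n} False (\<lambda>_. bernoulli_pmf p))"

definition mu :: "nat \<Rightarrow> nat set set \<Rightarrow> real \<Rightarrow> real" where
  "mu n \<A> p = measure_pmf.prob (random_subset n p) \<A>"

definition monotone_family :: "nat \<Rightarrow> nat set set \<Rightarrow> bool" where
  "monotone_family n \<A> \<longleftrightarrow> \<A> \<subseteq> Pow {0..n} \<and>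
     (\<forall>A B. A \<in> \<A> \<longrightarrow> A \<subseteq> B \<longrightarrow> B \<subseteq> {0..n} \<longrightarrow> B \<in> \<A>)"

definition nontrivial_family :: "nat \<Rightarrow> nat set set \<Rightarrow> bool" where
  "nontrivial_family n \<A> \<longleftrightarrow> \<A> \<noteq> {} \<and> \<A> \<noteq> Pow {0..n}"

definition minterms :: "nat set set \<Rightarrow> nat set set" where
  "minterms \<A> = {A \<in> \<A>. \<forall>B \<in> \<A>. B \<subseteq> A \<longrightarrow> B = A}"

(* Meaningful for non-trivial monotone families and x in [0,1], where mu n A is a continuous
   strictly increasing bijection of [0,1].  The restriction to [0,1] is needed because
   bernoulli_pmf clamps its parameter to that interval. *)
definition p_at :: "nat \<Rightarrow> nat set set \<Rightarrow> real \<Rightarrow> real" where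
  "p_at n \<A> x = (THE p. p \<in> {0..1} \<and> mu n \<A> p = x)"

definition delta :: "nat \<Rightarrow> real \<Rightarrow> nat set set \<Rightarrow> real" where
  "delta n \<epsilon> \<A> = (p_at n \<A> (1/2) - p_at n \<A> \<epsilon>) / p_at n \<A> (1/2)"

(* The inequality 1 - 2 * eps * (k-1)^(k-1) / k^k >= delta n eps A, stated for all k >= 1
   and 0 < eps < 1, fails for k = 1 and eps < 1/2 with the convention 0 ^ 0 = 1: for n = 1 and
   A = {{0}, {1}, {0,1}} one has mu n A p = 2 * p - p^2, hence p_at n A x = 1 - sqrt (1 - x) and
   delta n (1/4) A = 0.5425... > 1/2.  It is therefore stated with the additional hypothesis
   eps >= 1/2 in the case k = 1, and without any restriction on eps for k >= 2. *)

end

theory Submission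
  imports Defs
begin

text \<open>
  The union of independent copies of \<open>[n]\<^sub>p\<close> and \<open>[n]\<^sub>r\<close> is distributed as \<open>[n]\<^sub>s\<close> with
  \<open>s = p + r - p * r\<close>, and by monotonicity it misses \<open>\<A>\<close> only if both copies do. Hence
  \<open>1 - \<mu>(s) \<le> (1 - \<mu>(p)) * (1 - \<mu>(r))\<close>. This yields strict monotonicity of \<open>\<mu>\<close> and, iterated
  \<open>m = \<lceil>1/\<epsilon>\<rceil>\<close> times from \<open>p = p\<^sub>\<epsilon>\<close>, the bound \<open>p\<^bsub>1/2\<^esub> \<le> m * p\<^sub>\<epsilon> \<le> (2/\<epsilon>) * p\<^sub>\<epsilon>\<close>
  (the Bollobas--Thomason argument). As \<open>(k-1)^(k-1) / k^k \<le> 1/4\<close> for \<open>k \<ge> 2\<close>, this suffices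
  there. For \<open>k = 1\<close> the family consists of the sets meeting some fixed set \<open>S\<close>, so
  \<open>\<mu>(p) = 1 - (1 - p) ^ card S\<close> is concave, and \<open>p\<^sub>x / x\<close> is nondecreasing in \<open>x\<close>.
\<close>

section \<open>Unions of independent random subsets\<close>

lemma random_subset_union:
  assumes p: "p \<in> {0..1}" and r: "r \<in> {0..1}"
  shows "random_subset n (p + r - p * r) =
    map_pmf (\<lambda>(X, Y). X \<union> Y) (pair_pmf (random_subset n p) (random_subset n r))"
proof -
  \<comment> \<open>The new parameter must lie in the unit interval, since
    \<open>bernoulli_pmf\<close> clamps its argument.\<close>
  have "1 - (p + r - p * r) = (1 - p) * (1 - r)"
    by (simp add: algebra_simps)
  moreover have "0 \<le> (1 - p) * (1 - r)" "(1 - p) * (1 - r) \<le> 1"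
    using p r by (auto intro: mult_le_one)
  ultimately have s: "0 \<le> p + r - p * r" "p + r - p * r \<le> 1"
    by linarith+
  \<comment> \<open>Coordinates are independent, so one coordinate suffices: a disjunction of two
    independent bits is false with probability \<open>(1 - p) * (1 - r)\<close>.\<close>
  have b: "bernoulli_pmf (p + r - p * r) =
    bind_pmf (bernoulli_pmf p) (\<lambda>b. bind_pmf (bernoulli_pmf r) (\<lambda>c. return_pmf (b \<or> c)))"
  proof (rule pmf_eqI)
    fix i :: bool
    show "pmf (bernoulli_pmf (p + r - p * r)) i = pmf (bind_pmf (bernoulli_pmf p)
      (\<lambda>b. bind_pmf (bernoulli_pmf r) (\<lambda>c. return_pmf (b \<or> c)))) i"
      using p r s by (cases i) (auto simp: pmf_bind algebra_simps)
  qed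
  have "Pi_pmf {0..n} False (\<lambda>_. bernoulli_pmf (p + r - p * r)) =
    do {f \<leftarrow> Pi_pmf {0..n} False (\<lambda>_. bernoulli_pmf p);
        g \<leftarrow> Pi_pmf {0..n} False (\<lambda>_. bernoulli_pmf r);
        return_pmf (\<lambda>x. if x \<in> {0..n} then f x \<or> g x else False)}"
    unfolding b by (simp add: Pi_pmf_bind[where d' = False])
  moreover have "{i \<in> {0..n}. if i \<in> {0..n} then f i \<or> g i else False} =
      {i \<in> {0..n}. f i} \<union> {i \<in> {0..n}. g i}" for f g :: "nat \<Rightarrow> bool"
    by auto
  ultimately show ?thesis
    unfolding random_subset_def
    by (simp add: map_bind_pmf pair_pmf_def bind_map_pmf map_pmf_def bind_assoc_pmf bind_return_pmf)
qed

lemma one_minus_mu: "1 - mu n \<A> p = measure_pmf.prob (random_subset n p) (- \<A>)"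
  unfolding mu_def using measure_pmf.prob_compl[of \<A> "random_subset n p"]
  by (simp add: Compl_eq_Diff_UNIV)

lemma mu_bounds: "0 \<le> mu n \<A> p" "mu n \<A> p \<le> 1"
  unfolding mu_def by auto

lemma set_random_subset: "set_pmf (random_subset n p) \<subseteq> Pow {0..n}"
  unfolding random_subset_def by auto

lemma one_minus_mu_union:
  assumes mono: "monotone_family n \<A>" and p: "p \<in> {0..1}" and r: "r \<in> {0..1}"
  shows "1 - mu n \<A> (p + r - p * r) \<le> (1 - mu n \<A> p) * (1 - mu n \<A> r)"
proof -
  let ?C = "Pow {0..n} - \<A>"
  let ?P = "pair_pmf (random_subset n p) (random_subset n r)"
  \<comment> \<open>Cutting \<open>- \<A>\<close> down to subsets of \<open>{0..n}\<close> makes the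
    inclusion below true and supplies the countability that the product rule needs.\<close>
  have prob_C: "measure_pmf.prob (random_subset n q) ?C = 1 - mu n \<A> q" for q
    unfolding one_minus_mu by (rule measure_pmf.finite_measure_eq_AE)
      (use set_random_subset in \<open>auto simp: AE_measure_pmf_iff\<close>)
  have "1 - mu n \<A> (p + r - p * r) = measure_pmf.prob ?P ((\<lambda>(X, Y). X \<union> Y) -` ?C)"
    unfolding prob_C[symmetric] random_subset_union[OF p r] by simp
  also have "\<dots> \<le> measure_pmf.prob ?P (?C \<times> ?C)"
  proof (rule measure_pmf.finite_measure_mono)
    show "(\<lambda>(X, Y). X \<union> Y) -` ?C \<subseteq> ?C \<times> ?C"
    proof (clarsimp, safe)
      fix X Y assume XY: "X \<subseteq> {0..n}" "Y \<subseteq> {0..n}" "X \<union> Y \<notin> \<A>"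
      show False if "X \<in> \<A>"
        using mono XY that unfolding monotone_family_def by (meson Un_least Un_upper1)
      show False if "Y \<in> \<A>"
        using mono XY that unfolding monotone_family_def by (meson Un_least Un_upper2)
    qed
  qed simp
  also have "\<dots> = (1 - mu n \<A> p) * (1 - mu n \<A> r)"
    by (subst measure_pmf_prob_product) (auto simp: prob_C intro: countable_finite)
  finally show ?thesis .
qed

text \<open>An element escapes \<open>m\<close> independent copies with probability
  \<open>(1 - p) ^ m\<close>, which gives the parameter of their union.\<close>

lemma one_minus_mu_iterate:
  assumes mono: "monotone_family n \<A>" and p: "p \<in> {0..1}"
  shows "1 - mu n \<A> (1 - (1 - p) ^ m) \<le> (1 - mu n \<A> p) ^ m"
proof (induction m)
  case 0
  show ?case using mu_bounds by simp
next
  case (Suc m)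
  have r: "1 - (1 - p) ^ m \<in> {0..1}"
    using p by (auto intro: power_le_one)
  have "1 - (1 - p) ^ Suc m = p + (1 - (1 - p) ^ m) - p * (1 - (1 - p) ^ m)"
    by (simp add: algebra_simps)
  then have "1 - mu n \<A> (1 - (1 - p) ^ Suc m)
      \<le> (1 - mu n \<A> p) * (1 - mu n \<A> (1 - (1 - p) ^ m))"
    using one_minus_mu_union[OF mono p r] by metis
  also have "\<dots> \<le> (1 - mu n \<A> p) * (1 - mu n \<A> p) ^ m"
    using Suc mu_bounds by (intro mult_left_mono) auto
  finally show ?case by simp
qed

section \<open>Point probabilities and continuity of \<open>mu\<close>\<close>

lemma pmf_random_subset:
  assumes p: "p \<in> {0..1}" and B: "B \<subseteq> {0..n}"
  shows "pmf (random_subset n p) B = (\<Prod>i\<in>{0..n}. if i \<in> B then p else 1 - p)"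
proof -
  let ?M = "Pi_pmf {0..n} False (\<lambda>_. bernoulli_pmf p)"
  have "pmf (random_subset n p) B = measure_pmf.prob ?M ((\<lambda>f. {i \<in> {0..n}. f i}) -` {B})"
    unfolding random_subset_def by (simp add: pmf_map)
  also have "\<dots> = measure_pmf.prob ?M {\<lambda>i. i \<in> B}"
  \<comment> \<open>On the support, \<open>f\<close> has the default \<open>False\<close> outside
    \<open>{0..n}\<close>, so the set it selects determines it.\<close>
  proof (rule measure_pmf.finite_measure_eq_AE)
    show "AE f in ?M. f \<in> (\<lambda>f. {i \<in> {0..n}. f i}) -` {B} \<longleftrightarrow> f \<in> {\<lambda>i. i \<in> B}"
      using set_Pi_pmf_subset[of "{0..n}" False "\<lambda>_. bernoulli_pmf p"] B
      by (fastforce simp: AE_measure_pmf_iff)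
  qed auto
  also have "\<dots> = (\<Prod>i\<in>{0..n}. pmf (bernoulli_pmf p) (i \<in> B))"
    unfolding measure_pmf_single using B by (intro pmf_Pi') auto
  also have "\<dots> = (\<Prod>i\<in>{0..n}. if i \<in> B then p else 1 - p)"
    using p by (intro prod.cong) auto
  finally show ?thesis .
qed

lemma mu_eq_sum:
  assumes "\<A> \<subseteq> Pow {0..n}" and "p \<in> {0..1}"
  shows "mu n \<A> p = (\<Sum>B\<in>\<A>. \<Prod>i\<in>{0..n}. if i \<in> B then p else 1 - p)"
proof -
  have "finite \<A>" using assms(1) by (rule finite_subset) simp
  then have "mu n \<A> p = (\<Sum>B\<in>\<A>. pmf (random_subset n p) B)"
    unfolding mu_def by (rule measure_measure_pmf_finite)
  also have "\<dots> = (\<Sum>B\<in>\<A>. \<Prod>i\<in>{0..n}. if i \<in> B then p else 1 - p)"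
    using assms by (intro sum.cong pmf_random_subset) auto
  finally show ?thesis .
qed

lemma continuous_on_mu:
  assumes "\<A> \<subseteq> Pow {0..n}"
  shows "continuous_on {0..1} (mu n \<A>)"
proof -
  have "continuous_on {0..1} (\<lambda>p. if i \<in> B then p else 1 - p :: real)" for i and B :: "nat set"
    by (cases "i \<in> B") (auto intro!: continuous_intros)
  then have "continuous_on {0..1}
      (\<lambda>p. \<Sum>B\<in>\<A>. \<Prod>i\<in>{0..n}. if i \<in> B then p else 1 - p :: real)"
    by (intro continuous_on_sum continuous_on_prod) auto
  then show ?thesis
    by (rule continuous_on_eq) (simp add: mu_eq_sum[OF assms])
qed

section \<open>Strict monotonicity of \<open>mu\<close> and comparison of the quantiles
  \<open>p_at\<close>\<close>

context
  fixes n :: nat and \<A> :: "nat set set"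
  assumes mono: "monotone_family n \<A>" and nontriv: "nontrivial_family n \<A>"
begin

lemma full_set_mem: "{0..n} \<in> \<A>"
  using mono nontriv unfolding monotone_family_def nontrivial_family_def by blast

lemma empty_set_notin: "{} \<notin> \<A>"
  using mono nontriv unfolding monotone_family_def nontrivial_family_def by blast

text \<open>The full set alone has this probability. With the dual bound from the empty set, this
  fixes the endpoint values of \<open>mu\<close> and supplies the strictness in
  \<open>mu_strict_mono\<close>.\<close>

lemma mu_ge:
  assumes "p \<in> {0..1}"
  shows "p ^ Suc n \<le> mu n \<A> p"
proof -
  have "p ^ Suc n = measure_pmf.prob (random_subset n p) {{0..n}}"
    using assms by (simp add: measure_pmf_single pmf_random_subset)
  also have "\<dots> \<le> mu n \<A> p"
    unfolding mu_def using full_set_mem by (intro measure_pmf.finite_measure_mono) auto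
  finally show ?thesis .
qed

lemma one_minus_mu_ge:
  assumes "p \<in> {0..1}"
  shows "(1 - p) ^ Suc n \<le> 1 - mu n \<A> p"
proof -
  have "(1 - p) ^ Suc n = measure_pmf.prob (random_subset n p) {{}}"
    using assms by (simp add: measure_pmf_single pmf_random_subset)
  also have "\<dots> \<le> 1 - mu n \<A> p"
    unfolding one_minus_mu using empty_set_notin by (intro measure_pmf.finite_measure_mono) auto
  finally show ?thesis .
qed

lemma mu_0: "mu n \<A> 0 = 0"
  using one_minus_mu_ge[of 0] mu_bounds[of n \<A> 0] by simp

lemma mu_1: "mu n \<A> 1 = 1"
  using mu_ge[of 1] mu_bounds[of n \<A> 1] by simp

lemma mu_strict_mono:
  assumes "0 \<le> p" "p < q" "q \<le> 1"
  shows "mu n \<A> p < mu n \<A> q"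
proof -
  \<comment> \<open>Chosen so that a copy with parameter \<open>p\<close> joined with an independent
    one with parameter \<open>r\<close> has parameter \<open>q\<close>.\<close>
  define r where "r = (q - p) / (1 - p)"
  have r: "0 < r" "r \<le> 1"
    using assms unfolding r_def by (auto simp: field_simps)
  have "r * (1 - p) = q - p"
    using assms unfolding r_def by simp
  then have q: "q = p + r - p * r"
    by (simp add: algebra_simps)
  have "0 < 1 - mu n \<A> p"
    using order_less_le_trans[OF zero_less_power one_minus_mu_ge] assms by simp
  moreover have "0 < mu n \<A> r"
    using order_less_le_trans[OF zero_less_power mu_ge] r by simp
  ultimately have "(1 - mu n \<A> p) * (1 - mu n \<A> r) < (1 - mu n \<A> p) * 1"
    by (intro mult_strict_left_mono) auto
  moreover have "1 - mu n \<A> q \<le> (1 - mu n \<A> p) * (1 - mu n \<A> r)"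
    unfolding q using assms r by (intro one_minus_mu_union mono) auto
  ultimately show ?thesis by simp
qed

text \<open>The intermediate value theorem gives existence and strict monotonicity gives uniqueness,
  so the \<open>THE\<close> in \<open>p_at\<close> denotes.\<close>

lemma p_at:
  assumes "x \<in> {0..1}"
  shows p_at_bounds: "p_at n \<A> x \<in> {0..1}" and mu_p_at: "mu n \<A> (p_at n \<A> x) = x"
proof -
  have "\<exists>p\<ge>0. p \<le> 1 \<and> mu n \<A> p = x"
    using assms mono by (intro IVT') (auto simp: mu_0 mu_1 monotone_family_def continuous_on_mu)
  then have "\<exists>!p. p \<in> {0..1} \<and> mu n \<A> p = x"
    by (auto intro!: ex_ex1I) (metis linorder_neqE_linordered_idom mu_strict_mono order_less_irrefl)
  then have "p_at n \<A> x \<in> {0..1} \<and> mu n \<A> (p_at n \<A> x) = x"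
    unfolding p_at_def by (rule theI')
  then show "p_at n \<A> x \<in> {0..1}" "mu n \<A> (p_at n \<A> x) = x"
    by auto
qed

lemma p_at_le:
  assumes "x \<in> {0..1}" "p \<in> {0..1}" "x \<le> mu n \<A> p"
  shows "p_at n \<A> x \<le> p"
proof (rule ccontr)
  assume "\<not> ?thesis"
  then have "mu n \<A> p < mu n \<A> (p_at n \<A> x)"
    using assms p_at_bounds[of x] by (intro mu_strict_mono) auto
  then show False
    using assms mu_p_at by simp
qed

lemma p_at_half_le:
  assumes \<epsilon>: "0 < \<epsilon>" "\<epsilon> \<le> 1"
  shows "p_at n \<A> (1/2) \<le> 2 / \<epsilon> * p_at n \<A> \<epsilon>"
proof -
  define p where "p = p_at n \<A> \<epsilon>"
  have p: "p \<in> {0..1}" "mu n \<A> p = \<epsilon>"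
    unfolding p_def using p_at[of \<epsilon>] \<epsilon> by auto
  define m where "m = nat \<lceil>1 / \<epsilon>\<rceil>"
  \<comment> \<open>Rounding up a number that is at least 1 at most doubles it.\<close>
  have "0 < 1 / \<epsilon>" "1 \<le> 1 / \<epsilon>" using \<epsilon> by auto
  then have m: "1 / \<epsilon> \<le> real m" "real m \<le> 2 / \<epsilon>"
    unfolding m_def by linarith+
  \<comment> \<open>Bounding \<open>(1 + \<epsilon>) ^ m\<close> below by 2 halves
    \<open>(1 - \<epsilon>) ^ m\<close> without logarithms, because the product of the two powers is
    at most 1.\<close>
  have "2 \<le> 1 + real m * \<epsilon>"
    using m(1) \<epsilon> by (simp add: field_simps)
  also have "\<dots> \<le> (1 + \<epsilon>) ^ m"
    using \<epsilon> by (intro Bernoulli_inequality) auto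
  finally have "(1 - \<epsilon>) ^ m * 2 \<le> (1 - \<epsilon>) ^ m * (1 + \<epsilon>) ^ m"
    using \<epsilon> by (intro mult_left_mono) auto
  also have "\<dots> = (1 - \<epsilon>\<^sup>2) ^ m"
    by (simp add: power_mult_distrib[symmetric] algebra_simps power2_eq_square)
  also have "\<dots> \<le> 1"
    using \<epsilon> by (intro power_le_one) (auto simp: power_le_one)
  finally have "(1 - \<epsilon>) ^ m \<le> 1/2" by simp
  then have "1/2 \<le> mu n \<A> (1 - (1 - p) ^ m)"
    using one_minus_mu_iterate[OF mono p(1), of m] p(2) by simp
  then have "p_at n \<A> (1/2) \<le> 1 - (1 - p) ^ m"
    using p(1) by (intro p_at_le) (auto intro: power_le_one)
  also have "\<dots> \<le> real m * p"
    using Bernoulli_inequality[of "- p" m] p(1) by simp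
  also have "\<dots> \<le> 2 / \<epsilon> * p"
    using m(2) p(1) by (intro mult_right_mono) auto
  finally show ?thesis unfolding p_def .
qed

section \<open>Families whose minterms are singletons\<close>

lemma minterm_below:
  assumes "B \<in> \<A>"
  obtains M where "M \<in> minterms \<A>" "M \<subseteq> B"
proof -
  have "finite \<A>"
    using mono by (auto simp: monotone_family_def intro: finite_subset)
  from finite_has_minimal2[OF this assms] show ?thesis
    using that unfolding minterms_def by blast
qed

lemma singleton_minterms_family:
  assumes "\<forall>A \<in> minterms \<A>. card A \<le> 1"
  obtains S where "S \<subseteq> {0..n}" "\<A> = {B. B \<subseteq> {0..n} \<and> B \<inter> S \<noteq> {}}"
proof
  let ?S = "{i. {i} \<in> \<A>}"
  show "?S \<subseteq> {0..n}"
    using mono by (auto simp: monotone_family_def)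
  show "\<A> = {B. B \<subseteq> {0..n} \<and> B \<inter> ?S \<noteq> {}}"
  proof (intro set_eqI iffI)
    fix B assume B: "B \<in> \<A>"
    then have sub: "B \<subseteq> {0..n}"
      using mono by (auto simp: monotone_family_def)
    obtain M where M: "M \<in> minterms \<A>" "M \<subseteq> B"
      using minterm_below[OF B] .
    have "M \<in> \<A>" using M(1) by (simp add: minterms_def)
    \<comment> \<open>An infinite set would have \<open>card\<close> 0; with finiteness, only the
      empty set must be excluded.\<close>
    moreover have "finite M"
      using M(2) sub by (meson finite_atLeastAtMost finite_subset)
    moreover have "card M \<le> 1" using M(1) assms by auto
    ultimately obtain i where "M = {i}"
      using empty_set_notin by (metis card_1_singletonE card_eq_0_iff le_antisym less_one not_le)
    then show "B \<in> {B. B \<subseteq> {0..n} \<and> B \<inter> ?S \<noteq> {}}"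
      using \<open>M \<in> \<A>\<close> M(2) sub by auto
  next
    fix B assume "B \<in> {B. B \<subseteq> {0..n} \<and> B \<inter> ?S \<noteq> {}}"
    then obtain i where "B \<subseteq> {0..n}" "i \<in> B" "{i} \<in> \<A>" by auto
    then show "B \<in> \<A>"
      using mono unfolding monotone_family_def by (metis empty_subsetI insert_subset)
  qed
qed

end

lemma prob_random_subset_disjoint:
  assumes p: "p \<in> {0..1}" and S: "S \<subseteq> {0..n}"
  shows "measure_pmf.prob (random_subset n p) {B. B \<inter> S = {}} = (1 - p) ^ card S"
proof -
  \<comment> \<open>Avoiding \<open>S\<close> is a product event: coordinates in \<open>S\<close>
    are forced to \<open>False\<close>, the others are free.\<close>
  have "(\<lambda>f. {i \<in> {0..n}. f i}) -` {B. B \<inter> S = {}}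
      = Pi {0..n} (\<lambda>i. if i \<in> S then {False} else UNIV)"
    using S by (auto simp: Pi_def)
  then have "measure_pmf.prob (random_subset n p) {B. B \<inter> S = {}}
      = (\<Prod>i\<in>{0..n}. measure_pmf.prob (bernoulli_pmf p) (if i \<in> S then {False} else UNIV))"
    unfolding random_subset_def by (simp add: measure_Pi_pmf_Pi)
  also have "\<dots> = (\<Prod>i\<in>{0..n}. if i \<in> S then 1 - p else 1)"
    using p by (intro prod.cong) (auto simp: measure_pmf_single)
  also have "\<dots> = (1 - p) ^ card S"
    using S by (simp add: prod.If_cases Int_absorb1)
  finally show ?thesis .
qed

text \<open>This is convexity of \<open>y ^ s\<close> on \<open>[0, 1]\<close>, at the point
  \<open>1 - t * x = (1 - t) * 1 + t * (1 - x)\<close>.\<close>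

lemma power_one_minus_mult_le:
  fixes t x :: real
  assumes t: "0 \<le> t" "t \<le> 1" and x: "0 \<le> x" "x \<le> 1"
  shows "(1 - t * x) ^ s \<le> 1 - t + t * (1 - x) ^ s"
proof (induction s)
  case (Suc s)
  have tx: "0 \<le> t * x" "t * x \<le> 1"
    using t x by (auto intro: mult_le_one)
  have "(1 - t * x) ^ Suc s \<le> (1 - t * x) * (1 - t + t * (1 - x) ^ s)"
    using Suc tx by (simp add: mult_left_mono)
  also have "\<dots> = 1 - t + t * (1 - x) ^ Suc s - t * x * (1 - t) * (1 - (1 - x) ^ s)"
    by (simp add: algebra_simps)
  also have "\<dots> \<le> 1 - t + t * (1 - x) ^ Suc s"
    using t x by (simp add: power_le_one)
  finally show ?case .
qed simp

text \<open>Here \<open>mu\<close> is concave and vanishes at 0, so the chord from the origin lies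
  below the graph.\<close>

lemma mu_mult_ge_singleton_minterms:
  assumes S: "S \<subseteq> {0..n}" and \<A>: "\<A> = {B. B \<subseteq> {0..n} \<and> B \<inter> S \<noteq> {}}"
    and t: "0 \<le> t" "t \<le> 1" and p: "p \<in> {0..1}"
  shows "t * mu n \<A> p \<le> mu n \<A> (t * p)"
proof -
  have mu: "1 - mu n \<A> q = (1 - q) ^ card S" if "q \<in> {0..1}" for q
  proof -
    have "1 - mu n \<A> q = measure_pmf.prob (random_subset n q) {B. B \<inter> S = {}}"
      unfolding one_minus_mu \<A> by (rule measure_pmf.finite_measure_eq_AE)
        (use set_random_subset in \<open>auto simp: AE_measure_pmf_iff\<close>)
    then show ?thesis
      using prob_random_subset_disjoint[OF that S] by simp
  qed
  have "t * p \<in> {0..1}"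
    using t p by (auto intro: mult_le_one)
  then have "1 - mu n \<A> (t * p) \<le> 1 - t + t * (1 - mu n \<A> p)"
    using power_one_minus_mult_le[of t p "card S"] mu p t by simp
  then show ?thesis by (simp add: algebra_simps)
qed

section \<open>The numerical factor and the final inequality\<close>

lemma pred_power_pred_div_power_le:
  assumes "k \<ge> 2"
  shows "(real k - 1) ^ (k - 1) / real k ^ k \<le> 1/4"
proof -
  define j where "j = k - 1"
  have j: "k = Suc j" "j \<ge> 1" using assms unfolding j_def by auto
  \<comment> \<open>The reciprocal of the factor is \<open>(1 + 1 / j) ^ j * (j + 1)\<close>, and
    both of these terms are at least 2.\<close>
  have "2 \<le> (1 + 1 / real j) ^ j"
    using Bernoulli_inequality[of "1 / real j" j] j(2) by (simp add: order_trans[of "-1" 0])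
  then have "2 * real j ^ j \<le> (1 + 1 / real j) ^ j * real j ^ j"
    by (intro mult_right_mono) auto
  also have "\<dots> = (real j + 1) ^ j"
    using j(2) by (simp add: power_mult_distrib[symmetric] field_simps)
  finally have "2 * (2 * real j ^ j) \<le> (real j + 1) * (real j + 1) ^ j"
    using j(2) by (intro mult_mono) auto
  then show ?thesis
    unfolding j(1) by (simp add: divide_le_eq add.commute)
qed

theorem theorem2p2:
  fixes n k :: nat and \<A> :: "nat set set" and \<epsilon> :: real
  assumes "k \<ge> 1"
    and "monotone_family n \<A>"
    and "nontrivial_family n \<A>"
    and "\<forall>A \<in> minterms \<A>. card A \<le> k"
    and "0 < \<epsilon>" and "\<epsilon> < 1"
    and "k = 1 \<Longrightarrow> 1/2 \<le> \<epsilon>"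
  shows "1 - 2 * \<epsilon> * ((real k - 1) ^ (k - 1) / real k ^ k) \<ge> delta n \<epsilon> \<A>"
proof -
  define p where "p = p_at n \<A> \<epsilon>"
  define q where "q = p_at n \<A> (1/2)"
  define c where "c = (real k - 1) ^ (k - 1) / real k ^ k"
  note fam = assms(2,3)
  have p: "p \<in> {0..1}" "mu n \<A> p = \<epsilon>"
    unfolding p_def using p_at[OF fam, of \<epsilon>] assms(5,6) by auto
  have q: "q \<in> {0..1}" "mu n \<A> q = 1/2"
    unfolding q_def using p_at[OF fam, of "1/2"] by auto
  then have "q > 0"
    using mu_0[OF fam] by (cases "q = 0") auto
  \<comment> \<open>The claim with denominators cleared, as \<open>delta\<close> equals
    \<open>1 - p / q\<close>.\<close>
  have "2 * \<epsilon> * c * q \<le> p"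
  proof (cases "k = 1")
    case True
    then have \<epsilon>: "1/2 \<le> \<epsilon>" and "\<forall>A \<in> minterms \<A>. card A \<le> 1"
      using assms(4,7) by auto
    then obtain S where S: "S \<subseteq> {0..n}" "\<A> = {B. B \<subseteq> {0..n} \<and> B \<inter> S \<noteq> {}}"
      using singleton_minterms_family[OF fam] by blast
    \<comment> \<open>The scaling that takes the level \<open>\<epsilon>\<close> to 1/2;
      \<open>?t \<le> 1\<close> is exactly \<open>\<epsilon> \<ge> 1/2\<close>.\<close>
    let ?t = "1 / (2 * \<epsilon>)"
    have t: "0 \<le> ?t" "?t \<le> 1" using \<epsilon> by auto
    have "?t * \<epsilon> \<le> mu n \<A> (?t * p)"
      using mu_mult_ge_singleton_minterms[OF S t p(1)] p(2) by simp
    moreover have "?t * p \<in> {0..1}"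
      using mult_le_one[of ?t p] t p(1) assms(5) by auto
    ultimately have "q \<le> ?t * p"
      unfolding q_def using assms(5) by (intro p_at_le[OF fam]) auto
    \<comment> \<open>For \<open>k = 1\<close> the convention \<open>0 ^ 0 = 1\<close> gives
      \<open>c = 1\<close>.\<close>
    then show ?thesis
      using assms(5) True by (simp add: c_def field_simps)
  next
    case False
    then have "c \<le> 1/4"
      unfolding c_def using assms(1) by (intro pred_power_pred_div_power_le) auto
    then have "2 * \<epsilon> * c * q \<le> 2 * \<epsilon> * (1/4) * q"
      using assms(5) \<open>q > 0\<close> by (intro mult_right_mono mult_left_mono) auto
    also have "\<dots> \<le> p"
      using p_at_half_le[OF fam, of \<epsilon>] assms(5,6) unfolding p_def q_def
      by (simp add: field_simps)
    finally show ?thesis .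
  qed
  then have "2 * \<epsilon> * c \<le> p / q"
    using \<open>q > 0\<close> by (simp add: field_simps)
  moreover have "delta n \<epsilon> \<A> = 1 - p / q"
    unfolding delta_def p_def[symmetric] q_def[symmetric] using \<open>q > 0\<close>
    by (simp add: field_simps)
  ultimately show ?thesis
    unfolding c_def by simp
qed

end
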